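(* Let $\Omega\subset\mathbb{R}^d$ be open and bounded, $\Gamma\subset\mathbb{R}^s$ compact, $U:=\Omega\times\Gamma$. Let $u\in C^2(\Omega,\Gamma)$ and let $(H,E,\mu)\in\mathcal{M}(U,\mathbb{R}^{d,s,d,s}\times\mathbb{R}^{d,d,s}\times\mathbb{R})$ with $\mu=\delta_u$, $E=(\nabla^2u)\,\delta_u$ and $H=(\nabla u\otimes\nabla u)\,\delta_u$, in the sense that $$\int_U\langle\phi,\mathrm{d}E\rangle=\int_\Omega\langle\phi(x,u(x)),\nabla^2u(x)\rangle\,\mathrm{d}x\quad\forall\phi\in C_0(U,\mathbb{R}^{d,d,s}),$$ $$\int_U\langle\phi,\mathrm{d}H\rangle=\int_\Omega\langle\phi(x,u(x)),(\nabla u\otimes\nabla u)(x)\rangle\,\mathrm{d}x\quad\forall\phi\in C_0(U,\mathbb{R}^{d,s,d,s}).$$ Then $(H,E,\mu)$ solves the second-order continuity equation $-\nabla_x^2\mu-\operatorname{div}_zE+\operatorname{div}_z^2H=0$, i.e. $$-\int_U\operatorname{div}_x^2\phi\,\mathrm{d}\mu+\int_U\langle\nabla_z\phi,\mathrm{d}E\rangle+\int_U\langle\nabla_z^2\phi,\mathrm{d}H\rangle=0\qquad\forall\phi\in C_c^2(U,\mathbb{R}^{d,d}).$$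
   Context: Points of $U$ are written $(x,z)$ with $x\in\Omega$, $z\in\Gamma$; derivatives with index $x$ (resp. $z$) are with respect to the $\Omega$- (resp. $\Gamma$-) variable. $C_0(U,\mathbb{R}^k)$ is the closure in the supremum norm of the compactly supported continuous functions; $\mathcal{M}(U,\mathbb{R}^k)$ is the space of (finite) $\mathbb{R}^k$-valued Radon measures on $U$. The graph-concentrated measure $\delta_u$ is defined by $\int_U\phi\,\mathrm{d}\delta_u:=\int_\Omega\phi(x,u(x))\,\mathrm{d}x$ for all $\phi\in C_0(U,\mathbb{R})$. Tensor conventions ($i,j\in\{1,\dots,d\}$, $k,l\in\{1,\dots,s\}$; $\langle\cdot,\cdot\rangle$ is the Euclidean entrywise inner product): $(\nabla^2u)_{i,j,k}=\partial_{x_i}\partial_{x_j}u_k$, $(\nabla u\otimes\nabla u)_{i,k,j,l}=\partial_{x_i}u_k\,\partial_{x_j}u_l$; for $\phi=(\phi_{i,j})$: $\operatorname{div}_x^2\phi=\sum_{i,j}\partial_{x_i}\partial_{x_j}\phi_{i,j}$, $(\nabla_z\phi)_{i,j,k}=\partial_{z_k}\phi_{i,j}$, $(\nabla_z^2\phi)_{i,k,j,l}=\partial_{z_k}\partial_{z_l}\phi_{i,j}$. $C_c^2(U,\mathbb{R}^{d,d})$ denotes twice continuously differentiable functions with compact support in the first variable; concretely, functions $\phi$ of class $C^2$ on $\Omega\times\mathbb{R}^s$ for which there is a compact $K\subset\Omega$ with $\phi(x,z)=0$ for $x\notin K$, used on $\Omega\times\Gamma$. *)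

theory Defs
  imports "HOL-Analysis.Analysis"
begin

section \<open>Finite vector-valued Radon measures\<close>

text \<open>
  A vector measure on a Borel set \<open>U\<close> is a set function \<open>m\<close>; its values outside the Borel
  subsets of \<open>U\<close> are irrelevant.
\<close>

abbreviation borel_of :: "'a::topological_space set \<Rightarrow> 'a set set" where
  "borel_of U \<equiv> sets (restrict_space borel U)"

definition vector_measure_on ::
    "'a::topological_space set \<Rightarrow> ('a set \<Rightarrow> 'b::euclidean_space) \<Rightarrow> bool" where
  "vector_measure_on U m \<longleftrightarrow>
     (\<forall>A::nat \<Rightarrow> 'a set. range A \<subseteq> borel_of U \<and> disjoint_family A \<longrightarrow>
        (\<lambda>n. m (A n)) sums m (\<Union>n. A n))"

definition total_variation ::
    "'a::topological_space set \<Rightarrow> ('a set \<Rightarrow> 'b::euclidean_space) \<Rightarrow> 'a set \<Rightarrow> ennreal" where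
  "total_variation U m A =
     (SUP P \<in> {P. finite P \<and> P \<subseteq> borel_of U \<and> disjoint P \<and> \<Union>P = A}. \<Sum>B\<in>P. ennreal (norm (m B)))"

definition finite_radon_measure_on ::
    "'a::topological_space set \<Rightarrow> ('a set \<Rightarrow> 'b::euclidean_space) \<Rightarrow> bool" where
  "finite_radon_measure_on U m \<longleftrightarrow>
     vector_measure_on U m \<and>
     total_variation U m U < \<infinity> \<and>
     (\<forall>A\<in>borel_of U. total_variation U m A =
        (SUP K\<in>{K. compact K \<and> K \<subseteq> A}. total_variation U m K))"


section \<open>Integration against vector measures\<close>

text \<open>
  The positive part of the Jordan decomposition of a real-valued (signed) measure \<open>\<nu>\<close> is
  \<open>A \<mapsto> sup {\<nu> B | B \<subseteq> A Borel}\<close>.  Since \<open>ennreal\<close> truncates negative numbers to 0 and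
  \<open>\<nu> {} = 0\<close>, this is the supremum below.
\<close>

definition pos_part_measure ::
    "'a::topological_space set \<Rightarrow> ('a set \<Rightarrow> real) \<Rightarrow> 'a measure" where
  "pos_part_measure U \<nu> =
     measure_of U (borel_of U) (\<lambda>A. SUP B\<in>{B\<in>borel_of U. B \<subseteq> A}. ennreal (\<nu> B))"

definition signed_integral ::
    "'a::topological_space set \<Rightarrow> ('a \<Rightarrow> real) \<Rightarrow> ('a set \<Rightarrow> real) \<Rightarrow> real" where
  "signed_integral U f \<nu> =
     (LINT p|pos_part_measure U \<nu>. f p) - (LINT p|pos_part_measure U (\<lambda>A. - \<nu> A). f p)"

text \<open>
  \<open>pair_integral U \<phi> m\<close> is the integral over \<open>U\<close> of \<open>\<langle>\<phi>, dm\<rangle>\<close>.  For nested vectors \<open>Basis\<close>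
  consists of the unit tensors, so this is the sum over all entries; for \<open>m\<close> real-valued it is
  \<open>signed_integral U \<phi> m\<close>.
\<close>

definition pair_integral ::
    "'a::topological_space set \<Rightarrow> ('a \<Rightarrow> 'b::euclidean_space) \<Rightarrow> ('a set \<Rightarrow> 'b) \<Rightarrow> real" where
  "pair_integral U \<phi> m = (\<Sum>b\<in>Basis. signed_integral U (\<lambda>p. \<phi> p \<bullet> b) (\<lambda>A. m A \<bullet> b))"

lemma pair_integral_real: "pair_integral U \<phi> m = signed_integral U \<phi> m"
  by (simp add: pair_integral_def)

lemma space_pos_part_measure [simp]: "space (pos_part_measure U \<nu>) = U"
  unfolding pos_part_measure_def
  by (rule space_measure_of) (metis sets.space_closed space_borel space_restrict_space Int_UNIV_right)

lemma sets_pos_part_measure [simp]: "sets (pos_part_measure U \<nu>) = borel_of U"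
proof -
  have "sets (pos_part_measure U \<nu>) = sigma_sets U (borel_of U)"
    unfolding pos_part_measure_def
    by (rule sets_measure_of) (metis sets.space_closed space_borel space_restrict_space Int_UNIV_right)
  also have "\<dots> = borel_of U"
    using sets.sigma_sets_eq[of "restrict_space borel U"] by (simp add: space_restrict_space)
  finally show ?thesis .
qed

lemma vector_measure_on_empty:
  assumes "vector_measure_on U m"
  shows "m {} = 0"
proof -
  have "(\<lambda>n::nat. m {}) sums m {}"
    using assms[unfolded vector_measure_on_def, rule_format, of "\<lambda>n. {}"]
    by (auto simp: disjoint_family_on_def)
  then have "(\<lambda>n::nat. m {}) \<longlonglongrightarrow> 0"
    by (intro summable_LIMSEQ_zero) (auto simp: summable_def)
  then show ?thesis by (simp add: LIMSEQ_const_iff)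
qed

lemma vector_measure_on_Un:
  assumes "vector_measure_on U m" "A \<in> borel_of U" "B \<in> borel_of U" "A \<inter> B = {}"
  shows "m (A \<union> B) = m A + m B"
proof -
  have "range (binaryset A B) \<subseteq> borel_of U" "disjoint_family (binaryset A B)"
    using assms(2-) by (auto simp: range_binaryset_eq disjoint_family_on_def binaryset_def)
  then have "(\<lambda>n. m (binaryset A B n)) sums m (\<Union>n. binaryset A B n)"
    using assms(1) unfolding vector_measure_on_def by blast
  moreover have "(\<lambda>n. m (binaryset A B n)) sums (m A + m B)"
    by (intro binaryset_sums vector_measure_on_empty[OF assms(1)])
  ultimately show ?thesis
    by (simp add: UN_binaryset_eq sums_unique2)
qed

text \<open>\<open>measure_of\<close> returns the intended set function, i.e. the supremum is countably additive.\<close>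

lemma emeasure_pos_part_measure:
  assumes m: "vector_measure_on U \<nu>" and A: "A \<in> borel_of U"
  shows "emeasure (pos_part_measure U \<nu>) A = (SUP B\<in>{B\<in>borel_of U. B \<subseteq> A}. ennreal (\<nu> B))"
proof -
  define f where "f A = (SUP B\<in>{B\<in>borel_of U. B \<subseteq> A}. ennreal (\<nu> B))" for A
  have mono: "f A \<le> f B" if "A \<subseteq> B" for A B
    unfolding f_def using that by (intro SUP_subset_mono) auto
  have e0: "f {} = 0"
    by (auto simp: f_def vector_measure_on_empty[OF m] bot_ennreal intro!: antisym SUP_least)
  have f_Un: "f A + f B \<le> f (A \<union> B)" if AB: "A \<in> borel_of U" "B \<in> borel_of U" "A \<inter> B = {}" for A B
  proof -
    have *: "ennreal (\<nu> C) + ennreal (\<nu> D) \<le> f (A \<union> B)"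
      if "C \<in> borel_of U" "C \<subseteq> A" "D \<in> borel_of U" "D \<subseteq> B" for C D
    proof -
      have 1: "ennreal (\<nu> C) \<le> f (A \<union> B)" "ennreal (\<nu> D) \<le> f (A \<union> B)"
        unfolding f_def using that by (auto intro!: SUP_upper)
      show ?thesis
      proof (cases "\<nu> C \<ge> 0 \<and> \<nu> D \<ge> 0")
        case True
        have "C \<inter> D = {}" using that AB(3) by blast
        then have "\<nu> (C \<union> D) = \<nu> C + \<nu> D" by (rule vector_measure_on_Un[OF m that(1,3)])
        then have "ennreal (\<nu> C) + ennreal (\<nu> D) = ennreal (\<nu> (C \<union> D))"
          using True by simp
        also have "\<dots> \<le> f (A \<union> B)"
          unfolding f_def using that by (intro SUP_upper) auto
        finally show ?thesis .
      next
        case False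
        then show ?thesis using 1 by (auto simp: ennreal_neg)
      qed
    qed
    have ne: "{B' \<in> borel_of U. B' \<subseteq> B} \<noteq> {}" "{B' \<in> borel_of U. B' \<subseteq> A} \<noteq> {}" by auto
    have "ennreal (\<nu> C) + f B \<le> f (A \<union> B)" if "C \<in> borel_of U" "C \<subseteq> A" for C
    proof -
      have "ennreal (\<nu> C) + f B = (SUP D\<in>{B'\<in>borel_of U. B' \<subseteq> B}. ennreal (\<nu> C) + ennreal (\<nu> D))"
        unfolding f_def[of B] by (rule ennreal_SUP_add_right) (use ne in auto)
      also have "\<dots> \<le> f (A \<union> B)" using * that by (intro SUP_least) auto
      finally show ?thesis .
    qed
    note ** = this
    have "f A + f B = (SUP C\<in>{B'\<in>borel_of U. B' \<subseteq> A}. ennreal (\<nu> C) + f B)"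
      unfolding f_def[of A] by (rule ennreal_SUP_add_left[symmetric]) (use ne in auto)
    also have "\<dots> \<le> f (A \<union> B)" using ** by (intro SUP_least) auto
    finally show ?thesis .
  qed
  have ca: "countably_additive (borel_of U) f"
    unfolding countably_additive_def
  proof (intro allI impI antisym)
    fix F :: "nat \<Rightarrow> 'a set"
    assume F: "range F \<subseteq> borel_of U" "disjoint_family F" "(\<Union>i. F i) \<in> borel_of U"
    have fin: "(\<Sum>i<n. f (F i)) \<le> f (\<Union>i<n. F i)" for n
    proof (induction n)
      case (Suc n)
      have "(\<Sum>i<Suc n. f (F i)) \<le> f (\<Union>i<n. F i) + f (F n)"
        using Suc by (auto intro: add_right_mono)
      also have "\<dots> \<le> f ((\<Union>i<n. F i) \<union> F n)"
      proof (rule f_Un)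
        show "(\<Union>i<n. F i) \<in> borel_of U" using F(1) by (intro sets.finite_UN) auto
        show "F n \<in> borel_of U" using F(1) by auto
        have "F i \<inter> F n = {}" if "i < n" for i
          using F(2) that by (auto simp: disjoint_family_on_def dest!: spec[of _ i] spec[of _ n])
        then show "(\<Union>i<n. F i) \<inter> F n = {}" by blast
      qed
      also have "(\<Union>i<n. F i) \<union> F n = (\<Union>i<Suc n. F i)"
        by (auto simp: lessThan_Suc)
      finally show ?case .
    qed (simp add: e0)
    show "(\<Sum>i. f (F i)) \<le> f (\<Union>i. F i)"
      by (intro suminf_le_const summableI order_trans[OF fin] mono) auto
    show "f (\<Union>i. F i) \<le> (\<Sum>i. f (F i))"
      unfolding f_def[of "\<Union>i. F i"]
    proof (rule SUP_least)
      fix B assume "B \<in> {B \<in> borel_of U. B \<subseteq> (\<Union>i. F i)}"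
      then have B: "B \<in> borel_of U" "B = (\<Union>i. B \<inter> F i)" by auto
      have "(\<lambda>n. \<nu> (B \<inter> F n)) sums \<nu> (\<Union>n. B \<inter> F n)"
        using F(1,2) B(1)
        by (intro m[unfolded vector_measure_on_def, rule_format])
           (auto simp: disjoint_family_on_def)
      then have L: "(\<lambda>n. \<Sum>i<n. \<nu> (B \<inter> F i)) \<longlonglongrightarrow> \<nu> B"
        using B(2) by (simp add: sums_def)
      have "ennreal (\<Sum>i<n. \<nu> (B \<inter> F i)) \<le> (\<Sum>i. f (F i))" for n
      proof -
        have "ennreal (\<Sum>i<n. \<nu> (B \<inter> F i)) \<le> ennreal (\<Sum>i<n. max 0 (\<nu> (B \<inter> F i)))"
          by (intro ennreal_leI sum_mono) auto
        also have "\<dots> = (\<Sum>i<n. ennreal (max 0 (\<nu> (B \<inter> F i))))"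
          by (rule sum_ennreal[symmetric]) auto
        also have "\<dots> \<le> (\<Sum>i<n. f (F i))"
        proof (rule sum_mono)
          fix i
          have "ennreal (\<nu> (B \<inter> F i)) \<le> f (F i)"
            unfolding f_def using B(1) F(1) by (intro SUP_upper) auto
          then show "ennreal (max 0 (\<nu> (B \<inter> F i))) \<le> f (F i)"
            by (simp add: max_def ennreal_neg)
        qed
        also have "\<dots> \<le> (\<Sum>i. f (F i))" by (intro sum_le_suminf summableI) auto
        finally show ?thesis .
      qed
      moreover have "(\<lambda>n. ennreal (\<Sum>i<n. \<nu> (B \<inter> F i))) \<longlonglongrightarrow> ennreal (\<nu> B)"
        using L by (rule tendsto_ennrealI)
      ultimately show "ennreal (\<nu> B) \<le> (\<Sum>i. f (F i))"
        by (intro LIMSEQ_le_const2) auto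
    qed
  qed
  have "emeasure (pos_part_measure U \<nu>) A = f A"
  proof (rule emeasure_measure_of[where \<Omega>=U and A="borel_of U" and \<mu>=f])
    show "pos_part_measure U \<nu> = measure_of U (borel_of U) f"
      by (simp add: pos_part_measure_def f_def[abs_def])
    show "borel_of U \<subseteq> Pow U"
      by (metis sets.space_closed space_borel space_restrict_space Int_UNIV_right)
    show "positive (sets (pos_part_measure U \<nu>)) f" by (simp add: positive_def e0)
    show "countably_additive (sets (pos_part_measure U \<nu>)) f" using ca by simp
    show "A \<in> sets (pos_part_measure U \<nu>)" using A by simp
  qed
  then show ?thesis by (simp add: f_def)
qed


section \<open>Function spaces\<close>

text \<open>
  \<open>C0_on U\<close> and \<open>Cc_on U\<close> contain total functions, of which only the restriction to \<open>U\<close> matters.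
\<close>

definition Cc_on :: "'a::topological_space set \<Rightarrow> ('a \<Rightarrow> 'b::real_normed_vector) set" where
  "Cc_on U = {\<psi>. continuous_on U \<psi> \<and> (\<exists>K. compact K \<and> K \<subseteq> U \<and> (\<forall>p\<in>U - K. \<psi> p = 0))}"

definition C0_on :: "'a::topological_space set \<Rightarrow> ('a \<Rightarrow> 'b::real_normed_vector) set" where
  "C0_on U = {\<phi>. continuous_on U \<phi> \<and> (\<forall>e>0. \<exists>\<psi>\<in>Cc_on U. \<forall>p\<in>U. norm (\<phi> p - \<psi> p) \<le> e)}"

text \<open>Meaningful for open \<open>S\<close> only.\<close>

definition C2_on :: "'a::real_normed_vector set \<Rightarrow> ('a \<Rightarrow> 'b::real_normed_vector) \<Rightarrow> bool" where
  "C2_on S f \<longleftrightarrow>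
     (\<exists>(f' :: 'a \<Rightarrow> 'a \<Rightarrow>\<^sub>L 'b) (f'' :: 'a \<Rightarrow> 'a \<Rightarrow>\<^sub>L ('a \<Rightarrow>\<^sub>L 'b)).
        (\<forall>x\<in>S. (f has_derivative blinfun_apply (f' x)) (at x)) \<and>
        (\<forall>x\<in>S. (f' has_derivative blinfun_apply (f'' x)) (at x)) \<and>
        continuous_on S f'')"

text \<open>The support is compact in the first variable only.\<close>

definition C2c_on ::
    "'a::real_normed_vector set \<Rightarrow> ('a \<times> 'b::real_normed_vector \<Rightarrow> 'c::real_normed_vector) set" where
  "C2c_on \<Omega> = {\<phi>. C2_on (\<Omega> \<times> UNIV) \<phi> \<and>
     (\<exists>K. compact K \<and> K \<subseteq> \<Omega> \<and> (\<forall>x\<in>\<Omega> - K. \<forall>z. \<phi> (x, z) = 0))}"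


section \<open>Differential operators\<close>

definition dir_deriv :: "'a::real_normed_vector \<Rightarrow> ('a \<Rightarrow> real) \<Rightarrow> 'a \<Rightarrow> real" where
  "dir_deriv e f x = deriv (\<lambda>t. f (x + t *\<^sub>R e)) 0"

abbreviation pd :: "'d \<Rightarrow> (real^'d \<Rightarrow> real) \<Rightarrow> real^'d::finite \<Rightarrow> real" where
  "pd i \<equiv> dir_deriv (axis i 1)"

abbreviation pdx ::
    "'d \<Rightarrow> ((real^'d) \<times> (real^'s) \<Rightarrow> real) \<Rightarrow> (real^'d::finite) \<times> (real^'s::finite) \<Rightarrow> real" where
  "pdx i \<equiv> dir_deriv (axis i 1, 0)"

abbreviation pdz ::
    "'s \<Rightarrow> ((real^'d) \<times> (real^'s) \<Rightarrow> real) \<Rightarrow> (real^'d::finite) \<times> (real^'s::finite) \<Rightarrow> real" where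
  "pdz k \<equiv> dir_deriv (0, axis k 1)"

text \<open>
  Tensors are nested vectors with the outermost index first: \<open>T $ i $ j $ k\<close> for
  \<open>T :: real^'s^'d^'d\<close> and \<open>T $ i $ k $ j $ l\<close> for \<open>T :: real^'s^'d^'s^'d\<close>.
\<close>

definition hess :: "(real^'d \<Rightarrow> real^'s) \<Rightarrow> real^'d::finite \<Rightarrow> real^'s::finite^'d^'d" where
  "hess u x = (\<chi> i j k. pd i (pd j (\<lambda>y. u y $ k)) x)"

definition grad_tensor_grad ::
    "(real^'d \<Rightarrow> real^'s) \<Rightarrow> real^'d::finite \<Rightarrow> real^'s::finite^'d^'s^'d" where
  "grad_tensor_grad u x = (\<chi> i k j l. pd i (\<lambda>y. u y $ k) x * pd j (\<lambda>y. u y $ l) x)"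

definition div2_x ::
    "((real^'d) \<times> (real^'s) \<Rightarrow> real^'d^'d) \<Rightarrow> (real^'d::finite) \<times> (real^'s::finite) \<Rightarrow> real" where
  "div2_x \<phi> p = (\<Sum>i\<in>UNIV. \<Sum>j\<in>UNIV. pdx i (pdx j (\<lambda>q. \<phi> q $ i $ j)) p)"

definition grad_z ::
    "((real^'d) \<times> (real^'s) \<Rightarrow> real^'d^'d) \<Rightarrow> (real^'d::finite) \<times> (real^'s::finite)
       \<Rightarrow> real^'s^'d^'d" where
  "grad_z \<phi> p = (\<chi> i j k. pdz k (\<lambda>q. \<phi> q $ i $ j) p)"

definition hess_z ::
    "((real^'d) \<times> (real^'s) \<Rightarrow> real^'d^'d) \<Rightarrow> (real^'d::finite) \<times> (real^'s::finite)
       \<Rightarrow> real^'s^'d^'s^'d" where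
  "hess_z \<phi> p = (\<chi> i k j l. pdz k (pdz l (\<lambda>q. \<phi> q $ i $ j)) p)"


section \<open>The second-order continuity equation\<close>

text \<open>Weak form of \<open>- \<nabla>\<^sub>x\<^sup>2 \<mu> - div\<^sub>z E + div\<^sub>z\<^sup>2 H = 0\<close>.\<close>

definition solves_second_order_continuity_eq ::
    "(real^'d) set \<Rightarrow> (real^'s) set \<Rightarrow>
     (((real^'d) \<times> (real^'s)) set \<Rightarrow> real^'s^'d^'s^'d) \<Rightarrow>
     (((real^'d) \<times> (real^'s)) set \<Rightarrow> real^'s^'d^'d) \<Rightarrow>
     (((real^'d::finite) \<times> (real^'s::finite)) set \<Rightarrow> real) \<Rightarrow> bool" where
  "solves_second_order_continuity_eq \<Omega> \<Gamma> H E \<mu> \<longleftrightarrow>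
     (\<forall>\<phi>\<in>C2c_on \<Omega>.
        - pair_integral (\<Omega> \<times> \<Gamma>) (div2_x \<phi>) \<mu>
        + pair_integral (\<Omega> \<times> \<Gamma>) (grad_z \<phi>) E
        + pair_integral (\<Omega> \<times> \<Gamma>) (hess_z \<phi>) H = 0)"

end

theory Submission
  imports Defs
begin

text \<open>
  Testing with \<open>\<phi>\<close> turns the claim into an integral over \<open>\<Omega>\<close>, summed over \<open>i, j\<close>.  For
  \<open>f = \<phi>\<^sub>i\<^sub>j\<close>, the chain rule and the symmetry of \<open>D\<^sup>2 f\<close> show that the integrand is
  \<open>\<partial>\<^sub>i (\<partial>\<^sub>z f(x, u(x)) \<partial>\<^sub>j u(x)) - \<partial>\<^sub>j (\<partial>\<^sub>x\<^sub>i f(x, u(x)))\<close>, the mixed terms \<open>\<partial>\<^sub>x\<partial>\<^sub>z f\<close> cancelling.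
  The integral of a partial derivative of a compactly supported function vanishes, because it is
  the limit of the integrals of the difference quotients, which are zero by translation invariance.
\<close>

section \<open>Directional derivatives\<close>

text \<open>The base parameter \<open>t\<close> is arbitrary, not just 0, because the mean value
  theorem needs the derivative at every point of a segment.\<close>

lemma DERIV_along_line:
  assumes "(f has_derivative F) (at (x + t *\<^sub>R e))"
  shows "((\<lambda>s. f (x + s *\<^sub>R e)) has_real_derivative F e) (at t)"
proof -
  have "((\<lambda>s. f (x + s *\<^sub>R e)) has_derivative (\<lambda>h. F (h *\<^sub>R e))) (at t)"
    by (rule has_derivative_compose[where f="\<lambda>s. x + s *\<^sub>R e" and g=f])
      (auto intro!: derivative_eq_intros assms)
  moreover have "F (h *\<^sub>R e) = F e * h" for h
    using linear_cmul[OF has_derivative_linear[OF assms], of h e] by simp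
  ultimately show ?thesis
    by (simp add: has_field_derivative_def)
qed

lemma dir_deriv_eq:
  assumes "(f has_derivative F) (at x)"
  shows "dir_deriv e f x = F e"
  unfolding dir_deriv_def
  by (rule DERIV_imp_deriv, rule DERIV_along_line) (use assms in simp)

lemma dir_deriv_cong:
  assumes "open S" "x \<in> S" "\<And>y. y \<in> S \<Longrightarrow> f y = g y"
  shows "dir_deriv e f x = dir_deriv e g x"
  unfolding dir_deriv_def
proof (rule deriv_cong_ev)
  have "open ((\<lambda>t. x + t *\<^sub>R e) -` S)"
    by (intro open_vimage assms continuous_intros)
  then have "eventually (\<lambda>t. t \<in> (\<lambda>t. x + t *\<^sub>R e) -` S) (nhds 0)"
    by (rule eventually_nhds_in_open) (use assms in simp)
  then show "eventually (\<lambda>t. f (x + t *\<^sub>R e) = g (x + t *\<^sub>R e)) (nhds 0)"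
    by eventually_elim (use assms in auto)
qed simp

lemma dir_deriv_zero:
  assumes "open S" "x \<in> S" "\<And>y. y \<in> S \<Longrightarrow> f y = 0"
  shows "dir_deriv e f x = 0"
  using dir_deriv_cong[OF assms(1,2), of f "\<lambda>_. 0" e] assms(3) by (simp add: dir_deriv_def)

text \<open>The inner derivative equals \<open>f1 y e'\<close> on the whole neighbourhood
  \<open>S\<close> of \<open>x\<close>, and the outer one depends only on values near
  \<open>x\<close>.\<close>

lemma dir_deriv_dir_deriv_eq:
  assumes "open S" "x \<in> S" "\<And>y. y \<in> S \<Longrightarrow> (f has_derivative f1 y) (at y)"
    and "((\<lambda>y. f1 y e') has_derivative F) (at x)"
  shows "dir_deriv e (dir_deriv e' f) x = F e"
proof -
  have "dir_deriv e (dir_deriv e' f) x = dir_deriv e (\<lambda>y. f1 y e') x"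
    using assms(1,2) by (rule dir_deriv_cong) (rule dir_deriv_eq[OF assms(3)])
  then show ?thesis
    using dir_deriv_eq[OF assms(4)] by simp
qed

section \<open>Symmetry of second derivatives\<close>

text \<open>The mean value theorem is applied twice: along \<open>v\<close> to the difference of
  \<open>f\<close> on two lines offset by \<open>t *\<^sub>R w\<close>, then along \<open>w\<close>
  to \<open>f1\<close> evaluated at \<open>v\<close>. The second difference is symmetric in
  \<open>v\<close> and \<open>w\<close>, the right-hand side is not visibly so.\<close>

lemma second_difference_mean_value:
  fixes f :: "'a::real_normed_vector \<Rightarrow> real"
  assumes t: "t > 0" and sub: "cball p (t * (norm v + norm w)) \<subseteq> S"
    and f1: "\<And>x. x \<in> S \<Longrightarrow> (f has_derivative f1 x) (at x)"
    and f2: "\<And>x. x \<in> S \<Longrightarrow> ((\<lambda>y. f1 y v) has_derivative f2 x) (at x)"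
  shows "\<exists>x\<in>cball p (t * (norm v + norm w)).
    f (p + t *\<^sub>R v + t *\<^sub>R w) - f (p + t *\<^sub>R v) - f (p + t *\<^sub>R w) + f p = t * t * f2 x w"
proof -
  have near: "p + s *\<^sub>R v + r *\<^sub>R w \<in> cball p (t * (norm v + norm w))"
    if "0 \<le> s" "s \<le> t" "0 \<le> r" "r \<le> t" for s r
  proof -
    have "norm (s *\<^sub>R v + r *\<^sub>R w) \<le> s * norm v + r * norm w"
      using that norm_triangle_ineq[of "s *\<^sub>R v" "r *\<^sub>R w"] by simp
    also have "\<dots> \<le> t * norm v + t * norm w"
      using that by (intro add_mono mult_right_mono) auto
    moreover have "dist p (p + s *\<^sub>R v + r *\<^sub>R w) = norm (s *\<^sub>R v + r *\<^sub>R w)"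
      by (metis add.assoc add_diff_cancel_left' dist_commute dist_norm)
    ultimately show ?thesis
      by (simp add: algebra_simps)
  qed
  have inS: "p + s *\<^sub>R v + r *\<^sub>R w \<in> S" if "0 \<le> s" "s \<le> t" "0 \<le> r" "r \<le> t" for s r
    using near[OF that] sub by blast
  have "\<exists>s>0. s < t \<and> (f (p + t *\<^sub>R w + t *\<^sub>R v) - f (p + t *\<^sub>R v))
      - (f (p + t *\<^sub>R w + 0 *\<^sub>R v) - f (p + 0 *\<^sub>R v))
      = (t - 0) * (f1 (p + t *\<^sub>R w + s *\<^sub>R v) v - f1 (p + s *\<^sub>R v) v)"
  proof (rule MVT2[OF t])
    fix s assume s: "0 \<le> s" "s \<le> t"
    have "p + t *\<^sub>R w + s *\<^sub>R v \<in> S" "p + s *\<^sub>R v \<in> S"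
      using inS[of s t] inS[of s 0] s t by (simp_all add: add_ac)
    then show "((\<lambda>s. f (p + t *\<^sub>R w + s *\<^sub>R v) - f (p + s *\<^sub>R v)) has_real_derivative
        f1 (p + t *\<^sub>R w + s *\<^sub>R v) v - f1 (p + s *\<^sub>R v) v) (at s)"
      by (intro DERIV_diff DERIV_along_line f1)
  qed
  then obtain s where s: "0 < s" "s < t" and
    eq1: "f (p + t *\<^sub>R w + t *\<^sub>R v) - f (p + t *\<^sub>R v) - (f (p + t *\<^sub>R w) - f p)
      = t * (f1 (p + t *\<^sub>R w + s *\<^sub>R v) v - f1 (p + s *\<^sub>R v) v)"
    by auto
  have "\<exists>r>0. r < t \<and> f1 (p + s *\<^sub>R v + t *\<^sub>R w) v - f1 (p + s *\<^sub>R v + 0 *\<^sub>R w) v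
      = (t - 0) * f2 (p + s *\<^sub>R v + r *\<^sub>R w) w"
  proof (rule MVT2[OF t])
    fix r assume r: "0 \<le> r" "r \<le> t"
    show "((\<lambda>r. f1 (p + s *\<^sub>R v + r *\<^sub>R w) v) has_real_derivative
        f2 (p + s *\<^sub>R v + r *\<^sub>R w) w) (at r)"
      by (rule DERIV_along_line, rule f2, rule inS) (use r s in auto)
  qed
  then obtain r where r: "0 < r" "r < t" and
    eq2: "f1 (p + s *\<^sub>R v + t *\<^sub>R w) v - f1 (p + s *\<^sub>R v) v = t * f2 (p + s *\<^sub>R v + r *\<^sub>R w) w"
    by auto
  \<comment> \<open>Reordering turns the offset line of the first application into the endpoint
    \<open>r = t\<close> of the second.\<close>
  have swap: "p + t *\<^sub>R w + a *\<^sub>R v = p + a *\<^sub>R v + t *\<^sub>R w" for a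
    by simp
  have "f (p + t *\<^sub>R v + t *\<^sub>R w) - f (p + t *\<^sub>R v) - f (p + t *\<^sub>R w) + f p
      = t * t * f2 (p + s *\<^sub>R v + r *\<^sub>R w) w"
    using eq1[unfolded swap eq2] by simp
  then show ?thesis
    using r s near[of s r] by fastforce
qed

text \<open>The two orders of \<open>v\<close> and \<open>w\<close> express the same second
  difference through \<open>f2\<close> at two points near \<open>p\<close>. Both points tend to
  \<open>p\<close> as the step shrinks, and continuity of \<open>f2\<close> passes the equality to
  the limit.\<close>

lemma second_derivative_symmetric:
  fixes f :: "'a::real_normed_vector \<Rightarrow> real"
  assumes "open S" "p \<in> S"
    and f1: "\<And>x. x \<in> S \<Longrightarrow> (f has_derivative f1 x) (at x)"
    and f2: "\<And>x e. x \<in> S \<Longrightarrow> ((\<lambda>y. f1 y e) has_derivative (\<lambda>h. f2 x h e)) (at x)"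
    and cont: "\<And>h e. continuous_on S (\<lambda>x. f2 x h e)"
  shows "f2 p v w = f2 p w v"
proof -
  obtain r where r: "r > 0" "ball p r \<subseteq> S"
    using assms(1,2) openE by blast
  \<comment> \<open>The \<open>+ 1\<close> in the first denominator covers \<open>v = w = 0\<close>
    and keeps every closed ball strictly inside \<open>ball p r\<close>; \<open>n + 1\<close> avoids
    dividing by zero and makes the steps tend to 0.\<close>
  define t where "t n = r / (norm v + norm w + 1) / real (n + 1)" for n
  have tpos: "t n > 0" for n
    unfolding t_def using r by (intro divide_pos_pos add_nonneg_pos add_nonneg_nonneg norm_ge_zero) auto
  have t0: "t \<longlonglongrightarrow> 0"
    unfolding t_def by (rule LIMSEQ_Suc[OF lim_const_over_n, simplified Suc_eq_plus1])
  have sub: "cball p (t n * (norm v + norm w)) \<subseteq> S" for n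
  proof -
    have "t n * (norm v + norm w) \<le> r / (norm v + norm w + 1) * (norm v + norm w)"
      unfolding t_def using r by (intro mult_right_mono) (auto simp: divide_simps add_nonneg_pos)
    also have "\<dots> < r"
      using r by (simp add: divide_simps add_nonneg_pos)
    finally have "cball p (t n * (norm v + norm w)) \<subseteq> ball p r"
      by auto
    with r show ?thesis by blast
  qed
  have "\<exists>x y. x \<in> cball p (t n * (norm v + norm w)) \<and> y \<in> cball p (t n * (norm v + norm w)) \<and>
      f2 x w v = f2 y v w" for n
  proof -
    obtain x where x: "x \<in> cball p (t n * (norm v + norm w))"
      "f (p + t n *\<^sub>R v + t n *\<^sub>R w) - f (p + t n *\<^sub>R v) - f (p + t n *\<^sub>R w) + f p
         = t n * t n * f2 x w v"
      using second_difference_mean_value[OF tpos sub f1 f2] by blast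
    obtain y where y: "y \<in> cball p (t n * (norm w + norm v))"
      "f (p + t n *\<^sub>R w + t n *\<^sub>R v) - f (p + t n *\<^sub>R w) - f (p + t n *\<^sub>R v) + f p
         = t n * t n * f2 y v w"
      using second_difference_mean_value[OF tpos sub[unfolded add.commute[of "norm v"]] f1 f2] by blast
    have "t n * t n * f2 x w v = t n * t n * f2 y v w"
      using x(2) y(2) by (simp only: add.assoc add.commute[of "t n *\<^sub>R w"])
    then show ?thesis
      using x(1) y(1) tpos[of n] by (auto simp: add_ac)
  qed
  then obtain x y where xy: "\<And>n. x n \<in> cball p (t n * (norm v + norm w))"
    "\<And>n. y n \<in> cball p (t n * (norm v + norm w))" "\<And>n. f2 (x n) w v = f2 (y n) v w"
    by metis
  have conv: "z \<longlonglongrightarrow> p" if "\<And>n. z n \<in> cball p (t n * (norm v + norm w))" for z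
  proof (rule tendsto_dist_iff[THEN iffD2], rule tendsto_sandwich[where f="\<lambda>_. 0"])
    show "(\<lambda>n. t n * (norm v + norm w)) \<longlonglongrightarrow> 0"
      using tendsto_mult_left_zero[OF t0] .
  qed (use that in \<open>auto simp: dist_commute intro!: always_eventually\<close>)
  have lim: "(\<lambda>n. f2 (z n) h e) \<longlonglongrightarrow> f2 p h e" if "\<And>n. z n \<in> cball p (t n * (norm v + norm w))" for z h e
    using cont[of h e] conv[OF that] assms(1,2)
    by (intro isCont_tendsto_compose[of p "\<lambda>x. f2 x h e"]) (auto simp: continuous_on_eq_continuous_at)
  show ?thesis
    using lim[OF xy(1), of w v] lim[OF xy(2), of v w] xy(3) LIMSEQ_unique by auto
qed

section \<open>Integrals of derivatives of compactly supported functions\<close>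

text \<open>Lebesgue measure is its own image under a translation, the case of scaling factor 1 in
  \<open>lborel_affine\<close>.\<close>

lemma integral_translate_lborel:
  fixes g :: "'a::euclidean_space \<Rightarrow> real"
  assumes "g \<in> borel_measurable borel"
  shows "(LBINT x. g (x + c)) = (LBINT x. g x)"
    and "integrable lborel g \<Longrightarrow> integrable lborel (\<lambda>x. g (x + c))"
proof -
  have D: "distr lborel borel (\<lambda>x. x + c) = (lborel :: 'a measure)"
    using lborel_affine[of 1 c] by (simp add: density_1 add.commute)
  show "(LBINT x. g (x + c)) = (LBINT x. g x)"
    using integral_distr[of "\<lambda>x. x + c" lborel borel g] assms by (simp add: D)
  show "integrable lborel g \<Longrightarrow> integrable lborel (\<lambda>x. g (x + c))"
    using integrable_distr_eq[of "\<lambda>x. x + c" lborel borel g] assms by (simp add: D)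
qed

text \<open>On \<Omega> the function is its restriction to \<open>K\<close> extended by zero, and
  continuity on a compact set gives integrability. Thus a factor that is unbounded near the boundary
  of \<Omega> does no harm once multiplied by a test function.\<close>

lemma set_integrable_continuous_compact_support:
  fixes f :: "'a::euclidean_space \<Rightarrow> real"
  assumes "continuous_on \<Omega> f" "compact K" "K \<subseteq> \<Omega>" "\<And>x. x \<in> \<Omega> - K \<Longrightarrow> f x = 0"
  shows "set_integrable lborel \<Omega> f"
proof -
  have "integrable lborel (\<lambda>x. indicator K x *\<^sub>R f x)"
    using assms by (intro borel_integrable_compact continuous_on_subset[OF assms(1)])
  moreover have "(\<lambda>x. indicator K x *\<^sub>R f x) = (\<lambda>x. indicator \<Omega> x *\<^sub>R f x)"
    using assms(3,4) by (auto simp: indicator_def fun_eq_iff)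
  ultimately show ?thesis
    by (simp only: set_integrable_def)
qed

lemma integral_derivative_compact_support_UNIV:
  fixes g :: "'a::euclidean_space \<Rightarrow> real"
  assumes g': "\<And>x. (g has_derivative g' x) (at x)"
    and cont: "continuous_on UNIV (\<lambda>x. g' x e)"
    and K: "compact K" "\<And>x. x \<notin> K \<Longrightarrow> g x = 0"
  shows "(LBINT x. g' x e) = 0"
proof -
  have contg: "continuous_on UNIV g"
    using g' has_derivative_continuous_on has_derivative_at_withinI by blast
  have mg [measurable]: "g \<in> borel_measurable borel"
    by (rule borel_measurable_continuous_onI[OF contg])
  have mD [measurable]: "(\<lambda>x. g' x e) \<in> borel_measurable borel"
    by (rule borel_measurable_continuous_onI[OF cont])
  have ig: "integrable lborel g"
    using set_integrable_continuous_compact_support[OF contg K(1)] K(2)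
    by (auto simp: set_integrable_def)
  have D0: "g' x e = 0" if "x \<notin> K" for x
  proof -
    have "dir_deriv e g x = 0"
      by (rule dir_deriv_zero[of "-K"]) (use K that compact_imp_closed in auto)
    then show ?thesis using dir_deriv_eq[OF g'] by metis
  qed
  \<comment> \<open>\<open>B\<close> bounds the derivative on the compact set \<open>K\<close>; off
    \<open>K\<close> the derivative is zero.\<close>
  obtain B where B: "B \<ge> 0" "\<And>x. \<bar>g' x e\<bar> \<le> B"
  proof -
    have "bounded ((\<lambda>x. g' x e) ` K)"
      using K(1) cont by (intro compact_imp_bounded compact_continuous_image) (auto intro: continuous_on_subset)
    then obtain B where "B > 0" "\<And>x. x \<in> K \<Longrightarrow> \<bar>g' x e\<bar> \<le> B"
      by (auto simp: bounded_pos)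
    then show ?thesis using D0 by (intro that[of B]) (auto, metis abs_zero less_imp_le)
  qed
  \<comment> \<open>Starting at \<open>Suc n\<close> keeps the steps in the interval from 0
    (excluded) to 1, the range of shifts that \<open>K'\<close> allows for.\<close>
  define t where "t n = 1 / real (Suc n)" for n
  have t: "0 < t n" "t n \<le> 1" for n by (auto simp: t_def)
  have t0: "t \<longlonglongrightarrow> 0"
    unfolding t_def by (rule LIMSEQ_Suc[OF lim_const_over_n])
  define s where "s n x = (g (x + t n *\<^sub>R e) - g x) / t n" for n x
  \<comment> \<open>\<open>K'\<close> contains the supports of all quotients \<open>s n\<close>:
    such a quotient can be nonzero only if \<open>x\<close> or \<open>x + t n *\<^sub>R e\<close>
    lies in \<open>K\<close>.\<close>
  define K' where "K' = (\<lambda>(x, r). x - r *\<^sub>R e) ` (K \<times> {0..1::real})"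
  have K': "compact K'"
    unfolding K'_def case_prod_beta
    by (intro compact_continuous_image compact_Times K continuous_intros) auto
  have "(\<lambda>n. LBINT x. s n x) \<longlonglongrightarrow> (LBINT x. g' x e)"
  proof (rule integral_dominated_convergence)
    show "integrable lborel (\<lambda>x. indicator K' x *\<^sub>R B)"
      by (intro borel_integrable_compact K' continuous_intros)
    show "AE x in lborel. (\<lambda>n. s n x) \<longlonglongrightarrow> g' x e"
    proof (rule AE_I2)
      fix x
      have "((\<lambda>r. g (x + r *\<^sub>R e)) has_real_derivative g' x e) (at 0)"
        by (rule DERIV_along_line) (use g' in simp)
      then have "((\<lambda>h. (g (x + h *\<^sub>R e) - g x) / h) \<longlongrightarrow> g' x e) (at 0)"
        by (simp add: DERIV_def)
      moreover have "filterlim t (at 0) sequentially"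
        using t t0 by (intro filterlim_atI) (auto simp: less_imp_neq[symmetric] order_less_imp_not_eq2)
      ultimately show "(\<lambda>n. s n x) \<longlonglongrightarrow> g' x e"
        unfolding s_def by (rule filterlim_compose)
    qed
    show "AE x in lborel. norm (s n x) \<le> indicator K' x *\<^sub>R B" for n
    proof (rule AE_I2)
      fix x
      show "norm (s n x) \<le> indicator K' x *\<^sub>R B"
      proof (cases "x \<in> K'")
        case True
        \<comment> \<open>By the mean value theorem the quotient is a value of the derivative, hence
          at most \<open>B\<close> in absolute value, uniformly in \<open>n\<close>.\<close>
        have "\<exists>z>0. z < t n \<and> g (x + t n *\<^sub>R e) - g (x + 0 *\<^sub>R e) = (t n - 0) * g' (x + z *\<^sub>R e) e"
          by (rule MVT2[OF t(1)]) (intro DERIV_along_line g')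
        then obtain z where "g (x + t n *\<^sub>R e) - g x = t n * g' (x + z *\<^sub>R e) e"
          by auto
        then have "s n x = g' (x + z *\<^sub>R e) e"
          using t(1)[of n] by (simp add: s_def)
        then show ?thesis using B True by simp
      next
        case False
        \<comment> \<open>The shift \<open>r = 0\<close> shows that \<open>K\<close> is contained in
          \<open>K'\<close>.\<close>
        have "x \<notin> K"
          using False by (force simp: K'_def image_iff)
        moreover have "x + t n *\<^sub>R e \<notin> K"
        proof
          assume "x + t n *\<^sub>R e \<in> K"
          then have "(x + t n *\<^sub>R e, t n) \<in> K \<times> {0..1}" using t[of n] by auto
          from imageI[OF this, of "\<lambda>(x, r). x - r *\<^sub>R e"] show False
            using False by (simp add: K'_def)
        qed
        ultimately show ?thesis using K(2) B(1) by (simp add: s_def)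
      qed
    qed
  qed (simp_all add: s_def[abs_def])
  moreover have "(LBINT x. s n x) = 0" for n
    using integral_translate_lborel[OF mg, of "t n *\<^sub>R e"] ig by (simp add: s_def)
  ultimately show ?thesis
    by (simp add: LIMSEQ_const_iff)
qed

text \<open>Extension by zero reduces this to the whole space. The extension is \<open>g\<close> on
  \<Omega> and zero on the complement of \<open>K\<close>; these open sets cover the space because
  \<open>K\<close> lies in \<Omega>, so differentiability and continuity can be checked on
  each.\<close>

lemma integral_derivative_compact_support:
  fixes g :: "'a::euclidean_space \<Rightarrow> real"
  assumes \<Omega>: "open \<Omega>" and g': "\<And>x. x \<in> \<Omega> \<Longrightarrow> (g has_derivative g' x) (at x)"
    and cont: "continuous_on \<Omega> (\<lambda>x. g' x e)"
    and K: "compact K" "K \<subseteq> \<Omega>" "\<And>x. x \<in> \<Omega> - K \<Longrightarrow> g x = 0"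
  shows "(LBINT x:\<Omega>. g' x e) = 0" and "set_integrable lborel \<Omega> (\<lambda>x. g' x e)"
proof -
  define G where "G x = (if x \<in> \<Omega> then g x else 0)" for x
  define G' where "G' x = (if x \<in> \<Omega> then g' x else (\<lambda>_. 0))" for x
  have oK: "open (- K)" and oOK: "open (\<Omega> - K)"
    using K(1) \<Omega> by (auto intro: compact_imp_closed)
  have D0: "g' x e = 0" if "x \<in> \<Omega> - K" for x
    using dir_deriv_zero[where f=g and e=e, OF oOK that K(3)] dir_deriv_eq[OF g', where e=e] that by simp
  have G0: "G x = 0" if "x \<notin> K" for x
    using that K(3) by (auto simp: G_def)
  have "(LBINT x. G' x e) = 0"
  proof (rule integral_derivative_compact_support_UNIV[OF _ _ K(1) G0])
    show "(G has_derivative G' x) (at x)" for x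
    proof (cases "x \<in> \<Omega>")
      case True
      then show ?thesis
        using has_derivative_transform_within_open[OF g'[OF True] \<Omega> True, of G]
        by (simp add: G_def G'_def)
    next
      case False
      then show ?thesis
        using has_derivative_transform_within_open[OF has_derivative_const oK, where g=G and x=x] K(2) G0
        by (auto simp: G'_def)
    qed
    have "continuous_on \<Omega> (\<lambda>x. G' x e)"
      using cont by (simp add: G'_def cong: continuous_on_cong)
    moreover have "continuous_on (- K) (\<lambda>x. G' x e)"
      using D0 by (subst continuous_on_cong[OF refl, of _ _ "\<lambda>_. 0"]) (auto simp: G'_def)
    ultimately have "continuous_on (\<Omega> \<union> - K) (\<lambda>x. G' x e)"
      using \<Omega> oK continuous_on_open_Un by blast
    moreover have "\<Omega> \<union> - K = UNIV"
      using K(2) by blast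
    ultimately show "continuous_on UNIV (\<lambda>x. G' x e)"
      by simp
  qed
  moreover have "indicator \<Omega> x *\<^sub>R g' x e = G' x e" for x
    by (auto simp: G'_def indicator_def)
  ultimately show "(LBINT x:\<Omega>. g' x e) = 0"
    by (simp add: set_lebesgue_integral_def)
  show "set_integrable lborel \<Omega> (\<lambda>x. g' x e)"
    by (rule set_integrable_continuous_compact_support[OF cont K(1,2) D0])
qed

section \<open>Functions of class C2\<close>

text \<open>Composing with \<open>L\<close> is itself a bounded linear map \<open>C\<close> on the
  space of derivatives, so the derivatives of the composition are \<open>C\<close> applied to
  \<open>f'\<close> and \<open>f''\<close>. This gives access to the entries of \<phi> and
  \<open>u\<close>.\<close>

lemma C2_on_bounded_linear:
  fixes L :: "'b::real_normed_vector \<Rightarrow> 'c::real_normed_vector"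
  assumes L: "bounded_linear L" and f: "C2_on S f"
  shows "C2_on S (\<lambda>x. L (f x))"
proof -
  obtain f' f'' where f': "\<And>x. x \<in> S \<Longrightarrow> (f has_derivative blinfun_apply (f' x)) (at x)"
    and f'': "\<And>x. x \<in> S \<Longrightarrow> (f' has_derivative blinfun_apply (f'' x)) (at x)"
    and c: "continuous_on S f''"
    using f unfolding C2_on_def by blast
  define C :: "('a \<Rightarrow>\<^sub>L 'b) \<Rightarrow> ('a \<Rightarrow>\<^sub>L 'c)" where "C A = Blinfun L o\<^sub>L A" for A
  have C: "bounded_linear C"
    unfolding C_def[abs_def]
    by (rule bounded_bilinear.bounded_linear_right[OF bounded_bilinear_blinfun_compose])
  show ?thesis
    unfolding C2_on_def
  proof (intro exI conjI ballI)
    fix x assume x: "x \<in> S"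
    have "((\<lambda>x. L (f x)) has_derivative (\<lambda>h. L (f' x h))) (at x)"
      by (rule bounded_linear.has_derivative[OF L f'[OF x]])
    then show "((\<lambda>x. L (f x)) has_derivative blinfun_apply (C (f' x))) (at x)"
      by (simp add: C_def bounded_linear_Blinfun_apply[OF L] o_def blinfun_compose.rep_eq)
    have "((\<lambda>x. C (f' x)) has_derivative (\<lambda>h. C (f'' x h))) (at x)"
      by (rule bounded_linear.has_derivative[OF C f''[OF x]])
    then show "((\<lambda>x. C (f' x)) has_derivative blinfun_apply (Blinfun C o\<^sub>L f'' x)) (at x)"
      by (simp add: bounded_linear_Blinfun_apply[OF C] o_def blinfun_compose.rep_eq)
  next
    show "continuous_on S (\<lambda>x. Blinfun C o\<^sub>L f'' x)"
      by (intro continuous_intros c)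
  qed
qed

text \<open>Evaluation at a fixed \<open>e\<close> is bounded linear, which yields the derivative of
  \<open>f' y e\<close>, the form needed for iterated directional derivatives.\<close>

lemma C2_onE:
  fixes f :: "'a::real_normed_vector \<Rightarrow> 'b::real_normed_vector"
  assumes "open S" "C2_on S f"
  obtains f' :: "'a \<Rightarrow> 'a \<Rightarrow>\<^sub>L 'b" and f'' :: "'a \<Rightarrow> 'a \<Rightarrow>\<^sub>L 'a \<Rightarrow>\<^sub>L 'b"
  where "\<And>x. x \<in> S \<Longrightarrow> (f has_derivative blinfun_apply (f' x)) (at x)"
    and "\<And>x. x \<in> S \<Longrightarrow> (f' has_derivative blinfun_apply (f'' x)) (at x)"
    and "\<And>x e. x \<in> S \<Longrightarrow> ((\<lambda>y. f' y e) has_derivative (\<lambda>h. f'' x h e)) (at x)"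
    and "continuous_on S f" "continuous_on S f'" "continuous_on S f''"
proof -
  obtain f' f'' where f': "\<And>x. x \<in> S \<Longrightarrow> (f has_derivative blinfun_apply (f' x)) (at x)"
    and f'': "\<And>x. x \<in> S \<Longrightarrow> (f' has_derivative blinfun_apply (f'' x)) (at x)"
    and c: "continuous_on S f''"
    using assms(2) unfolding C2_on_def by blast
  show thesis
  proof (rule that[OF f' f'' _ _ _ c])
    show "((\<lambda>y. f' y e) has_derivative (\<lambda>h. f'' x h e)) (at x)" if "x \<in> S" for x e
      by (rule bounded_linear.has_derivative[OF blinfun.bounded_linear_left f''[OF that]])
    show "continuous_on S f"
      using f' has_derivative_continuous by (intro continuous_at_imp_continuous_on) blast
    show "continuous_on S f'"
      using f'' has_derivative_continuous by (intro continuous_at_imp_continuous_on) blast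
  qed
qed

lemma C2_on_continuous_dir_deriv:
  assumes "open S" "C2_on S f"
  shows "continuous_on S (dir_deriv e f)" "continuous_on S (dir_deriv e (dir_deriv e' f))"
proof -
  obtain f' f'' where f1: "\<And>x. x \<in> S \<Longrightarrow> (f has_derivative blinfun_apply (f' x)) (at x)"
    and "\<And>x. x \<in> S \<Longrightarrow> (f' has_derivative blinfun_apply (f'' x)) (at x)"
    and f2: "\<And>x e. x \<in> S \<Longrightarrow> ((\<lambda>y. f' y e) has_derivative (\<lambda>h. f'' x h e)) (at x)"
    and c: "continuous_on S f" "continuous_on S f'" "continuous_on S f''"
    by (fact C2_onE[OF assms])
  have "continuous_on S (\<lambda>x. f' x e)"
    by (intro continuous_intros c)
  then show "continuous_on S (dir_deriv e f)"
    by (rule continuous_on_eq) (simp add: dir_deriv_eq[OF f1])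
  have "continuous_on S (\<lambda>x. f'' x e e')"
    by (intro continuous_intros c)
  then show "continuous_on S (dir_deriv e (dir_deriv e' f))"
    by (rule continuous_on_eq) (simp add: dir_deriv_dir_deriv_eq[where f=f, OF assms(1) _ f1 f2])
qed

section \<open>Coordinates of vector-valued derivatives\<close>

lemma bounded_linear_vec_nth_vec_nth: "bounded_linear (\<lambda>T::real^'m^'n. T $ i $ j)"
  by (rule bounded_linear_compose[OF bounded_linear_vec_nth bounded_linear_vec_nth])

lemma linear_axis_sum:
  fixes g :: "real^'n \<Rightarrow> real"
  assumes "linear g"
  shows "g v = (\<Sum>k\<in>UNIV. v $ k * g (axis k 1))"
proof -
  have "g v = g (\<Sum>k\<in>UNIV. v $ k *\<^sub>R axis k 1)"
    using basis_expansion[of v] by (simp add: scalar_mult_eq_scaleR)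
  also have "\<dots> = (\<Sum>k\<in>UNIV. v $ k * g (axis k 1))"
    by (simp add: linear_sum[OF assms] linear_cmul[OF assms])
  finally show ?thesis .
qed

lemma dir_deriv_component:
  fixes u :: "'a::real_normed_vector \<Rightarrow> real^'n"
  assumes "(u has_derivative F) (at x)"
  shows "dir_deriv e (\<lambda>y. u y $ k) x = F e $ k"
  by (rule dir_deriv_eq[OF bounded_linear.has_derivative[OF bounded_linear_vec_nth assms]])

lemma dir_deriv_dir_deriv_component:
  fixes u :: "'a::real_normed_vector \<Rightarrow> real^'n"
  assumes "open S" "x \<in> S" "\<And>y. y \<in> S \<Longrightarrow> (u has_derivative u1 y) (at y)"
    and "((\<lambda>y. u1 y e') has_derivative F) (at x)"
  shows "dir_deriv e (dir_deriv e' (\<lambda>y. u y $ k)) x = F e $ k"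
  by (rule dir_deriv_dir_deriv_eq[OF assms(1,2)
      bounded_linear.has_derivative[OF bounded_linear_vec_nth assms(3)]
      bounded_linear.has_derivative[OF bounded_linear_vec_nth assms(4)]])

section \<open>Test functions along the graph\<close>

text \<open>The contribution of a single entry of the test function, taken on the graph of
  \<open>u\<close>. Its integral vanishes for each pair \<open>i\<close>, \<open>j\<close>
  separately, so the calculus can be done with a scalar \<open>f\<close>.\<close>

definition graph_integrand ::
    "'d \<Rightarrow> 'd \<Rightarrow> ((real^'d) \<times> (real^'s) \<Rightarrow> real) \<Rightarrow> (real^'d \<Rightarrow> real^'s)
       \<Rightarrow> real^'d::finite \<Rightarrow> real" where
  "graph_integrand i j (f :: (real^'d) \<times> (real^'s::finite) \<Rightarrow> real) u x =
     - pdx i (pdx j f) (x, u x)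
     + (\<Sum>k\<in>UNIV. pdz k f (x, u x) * pd i (pd j (\<lambda>y. u y $ k)) x)
     + (\<Sum>k\<in>UNIV. \<Sum>l\<in>UNIV. pdz k (pdz l f) (x, u x)
          * (pd i (\<lambda>y. u y $ k) x * pd j (\<lambda>y. u y $ l) x))"

lemma integral_graph_integrand:
  fixes f :: "(real^'d::finite) \<times> (real^'s::finite) \<Rightarrow> real" and u :: "real^'d \<Rightarrow> real^'s"
  assumes \<Omega>: "open \<Omega>" and f: "f \<in> C2c_on \<Omega>" and u: "C2_on \<Omega> u"
  shows "set_integrable lborel \<Omega> (graph_integrand i j f u)"
    and "(LBINT x:\<Omega>. graph_integrand i j f u x) = 0"
proof -
  define S where "S = \<Omega> \<times> (UNIV :: (real^'s) set)"
  have S: "open S"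
    unfolding S_def using \<Omega> by (intro open_Times) auto
  have C2: "C2_on S f"
    using f by (simp add: C2c_on_def S_def)
  obtain K where K: "compact K" "K \<subseteq> \<Omega>" "\<And>x z. x \<in> \<Omega> - K \<Longrightarrow> f (x, z) = 0"
    using f unfolding C2c_on_def by blast
  obtain f1 f2 where f1: "\<And>p. p \<in> S \<Longrightarrow> (f has_derivative blinfun_apply (f1 p)) (at p)"
    and f2: "\<And>p. p \<in> S \<Longrightarrow> (f1 has_derivative blinfun_apply (f2 p)) (at p)"
    and f2': "\<And>p e. p \<in> S \<Longrightarrow> ((\<lambda>q. f1 q e) has_derivative (\<lambda>h. f2 p h e)) (at p)"
    and cf: "continuous_on S f" "continuous_on S f1" "continuous_on S f2"
    by (fact C2_onE[OF S C2])
  obtain u1 u2 where u1: "\<And>x. x \<in> \<Omega> \<Longrightarrow> (u has_derivative blinfun_apply (u1 x)) (at x)"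
    and u2: "\<And>x. x \<in> \<Omega> \<Longrightarrow> (u1 has_derivative blinfun_apply (u2 x)) (at x)"
    and u2': "\<And>x e. x \<in> \<Omega> \<Longrightarrow> ((\<lambda>y. u1 y e) has_derivative (\<lambda>h. u2 x h e)) (at x)"
    and cu: "continuous_on \<Omega> u" "continuous_on \<Omega> u1" "continuous_on \<Omega> u2"
    by (fact C2_onE[OF \<Omega> u])
  have inS: "(x, u x) \<in> S" if "x \<in> \<Omega>" for x
    using that by (simp add: S_def)
  have cgraph: "continuous_on \<Omega> (\<lambda>x. (x, u x))"
    by (intro continuous_intros cu)
  have cf': "continuous_on \<Omega> (\<lambda>x. f1 (x, u x))" "continuous_on \<Omega> (\<lambda>x. f2 (x, u x))"
    using continuous_on_compose2[OF cf(2) cgraph] continuous_on_compose2[OF cf(3) cgraph] inS by auto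
  \<comment> \<open>The functions \<open>P\<close> and \<open>Q\<close> below are built from
    \<open>f1\<close>, so the vanishing of \<open>f\<close> off \<open>K\<close> is first passed to
    its derivative. It holds for every \<open>z\<close>, in particular along the graph.\<close>
  have zero: "f1 (x, z) e = 0" if "x \<in> \<Omega> - K" for x z e
  proof -
    have "dir_deriv e f (x, z) = 0"
    proof (rule dir_deriv_zero)
      show "open ((\<Omega> - K) \<times> (UNIV :: (real^'s) set))"
        using \<Omega> K(1) by (intro open_Times open_Diff compact_imp_closed) auto
    qed (use K(3) that in auto)
    then show ?thesis
      using dir_deriv_eq[OF f1[of "(x, z)"], of e] that by (simp add: S_def)
  qed
  have sym: "f2 p v w = f2 p w v" if "p \<in> S" for p v w
    by (rule second_derivative_symmetric[OF S that f1 f2']) (auto intro!: continuous_intros cf)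
  have dgraph: "((\<lambda>x. (x, u x)) has_derivative (\<lambda>h. (h, u1 x h))) (at x)" if "x \<in> \<Omega>" for x
    by (intro has_derivative_Pair has_derivative_ident u1 that)
  have df1: "((\<lambda>x. f1 (x, u x)) has_derivative (\<lambda>h. f2 (x, u x) (h, u1 x h))) (at x)" if "x \<in> \<Omega>" for x
    by (rule has_derivative_compose[OF dgraph[OF that] f2[OF inS[OF that]]])
  let ?ei = "axis i 1 :: real^'d" and ?ej = "axis j 1 :: real^'d"
  \<comment> \<open>\<open>P\<close> is the z-derivative of \<open>f\<close> on the graph in the
    direction of the \<open>j\<close>-th partial derivative of \<open>u\<close>, and
    \<open>Q\<close> is the \<open>i\<close>-th x-derivative of \<open>f\<close> on the graph.
    \<open>P'\<close> and \<open>Q'\<close> are their derivatives in direction \<open>h\<close>, by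
    the product and chain rules.\<close>
  define P where "P x = f1 (x, u x) (0, u1 x ?ej)" for x
  define P' where "P' x h = f1 (x, u x) (0, u2 x h ?ej) + f2 (x, u x) (h, u1 x h) (0, u1 x ?ej)" for x h
  define Q where "Q x = f1 (x, u x) (?ei, 0)" for x
  define Q' where "Q' x h = f2 (x, u x) (h, u1 x h) (?ei, 0)" for x h
  have dP: "(P has_derivative P' x) (at x)" if "x \<in> \<Omega>" for x
  proof -
    have "((\<lambda>x. (0 :: real^'d, u1 x ?ej)) has_derivative (\<lambda>h. (0, u2 x h ?ej))) (at x)"
      by (intro has_derivative_Pair has_derivative_const u2' that)
    from blinfun.FDERIV[OF df1[OF that] this] show ?thesis
      by (simp add: P_def[abs_def] P'_def[abs_def])
  qed
  have dQ: "(Q has_derivative Q' x) (at x)" if "x \<in> \<Omega>" for x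
    unfolding Q_def[abs_def] Q'_def[abs_def]
    by (rule bounded_linear.has_derivative[OF blinfun.bounded_linear_left df1[OF that]])
  have "continuous_on \<Omega> (\<lambda>x. P' x ?ei)" "continuous_on \<Omega> (\<lambda>x. Q' x ?ej)"
    unfolding P'_def Q'_def by (intro continuous_on_add blinfun.continuous_on continuous_on_Pair continuous_on_const cf' cu)+
  \<comment> \<open>The premise that \<open>P\<close> and \<open>Q\<close> vanish off
    \<open>K\<close> is left open here and discharged by \<open>zero\<close> in
    \<open>PQ\<close>.\<close>
  note P = integral_derivative_compact_support[OF \<Omega> dP this(1) K(1,2)]
    and Q = integral_derivative_compact_support[OF \<Omega> dQ this(2) K(1,2)]
  have W: "graph_integrand i j f u x = P' x ?ei - Q' x ?ej" if x: "x \<in> \<Omega>" for x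
  proof -
    let ?p = "(x, u x)"
    have split: "(h, v) = (h, 0) + (0, v)" for h :: "real^'d" and v :: "real^'s"
      by simp
    have emb: "bounded_linear (\<lambda>v. (0 :: real^'d, v :: real^'s))"
      by (intro bounded_linear_Pair bounded_linear_zero bounded_linear_ident)
    \<comment> \<open>\<open>z1\<close> and \<open>z2\<close> expand z-directions into partial
      derivatives, to match the sums over \<open>k\<close> and \<open>l\<close> in
      \<open>graph_integrand\<close>.\<close>
    have z1: "f1 ?p (0, v) = (\<Sum>k\<in>UNIV. v $ k * f1 ?p (0, axis k 1))" for v
      by (rule linear_axis_sum, rule bounded_linear.linear,
          rule bounded_linear_compose[OF blinfun.bounded_linear_right emb])
    have z2: "f2 ?p (0, v) (0, w) = (\<Sum>k\<in>UNIV. \<Sum>l\<in>UNIV. v $ k * (w $ l * f2 ?p (0, axis k 1) (0, axis l 1)))" for v w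
    proof -
      have "f2 ?p (0, v) (0, w) = (\<Sum>k\<in>UNIV. v $ k * f2 ?p (0, axis k 1) (0, w))"
        by (rule linear_axis_sum, rule bounded_linear.linear,
            rule bounded_linear_compose[OF blinfun.bounded_linear_left
              bounded_linear_compose[OF blinfun.bounded_linear_right emb]])
      moreover have "f2 ?p (0, axis k 1) (0, w) = (\<Sum>l\<in>UNIV. w $ l * f2 ?p (0, axis k 1) (0, axis l 1))" for k
        by (rule linear_axis_sum, rule bounded_linear.linear,
            rule bounded_linear_compose[OF blinfun.bounded_linear_right emb])
      ultimately show ?thesis by (simp add: sum_distrib_left)
    qed
    have df: "dir_deriv e f ?p = f1 ?p e" "dir_deriv e (dir_deriv e' f) ?p = f2 ?p e e'" for e e'
      using dir_deriv_eq[OF f1[OF inS[OF x]]]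
        dir_deriv_dir_deriv_eq[where f=f, OF S inS[OF x] f1 f2'[OF inS[OF x]]] by auto
    have du: "dir_deriv e (\<lambda>y. u y $ k) x = u1 x e $ k"
      "dir_deriv e (dir_deriv e' (\<lambda>y. u y $ k)) x = u2 x e e' $ k" for e e' k
      using dir_deriv_component[OF u1[OF x]]
        dir_deriv_dir_deriv_component[where u=u, OF \<Omega> x u1 u2'[OF x]] by auto
    have "graph_integrand i j f u x
      = - f2 ?p (?ei, 0) (?ej, 0) + f1 ?p (0, u2 x ?ei ?ej) + f2 ?p (0, u1 x ?ei) (0, u1 x ?ej)"
      unfolding graph_integrand_def z1[of "u2 x ?ei ?ej"] z2[of "u1 x ?ei" "u1 x ?ej"]
        df du
      by (simp add: mult_ac)
    \<comment> \<open>After splitting each direction into its x- and z-part, symmetry is used twice: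
      the mixed terms of \<open>P'\<close> and \<open>Q'\<close> cancel, and the two x-directions in
      the remaining term of \<open>Q'\<close> change places.\<close>
    also have "\<dots> = P' x ?ei - Q' x ?ej"
      unfolding P'_def Q'_def split[of ?ei "u1 x ?ei"] split[of ?ej "u1 x ?ej"]
        blinfun.add_right blinfun.add_left
      using sym[OF inS[OF x]] by simp
    finally show ?thesis .
  qed
  have PQ: "set_integrable lborel \<Omega> (\<lambda>x. P' x ?ei)" "(LBINT x:\<Omega>. P' x ?ei) = 0"
    "set_integrable lborel \<Omega> (\<lambda>x. Q' x ?ej)" "(LBINT x:\<Omega>. Q' x ?ej) = 0"
    using P Q zero by (simp_all add: P_def Q_def)
  note set_integral_diff[OF PQ(1,3)]
  moreover have "set_integrable lborel \<Omega> (graph_integrand i j f u) =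
      set_integrable lborel \<Omega> (\<lambda>x. P' x ?ei - Q' x ?ej)"
    by (rule set_integrable_cong) (use W in auto)
  moreover have "(LBINT x:\<Omega>. graph_integrand i j f u x) = (LBINT x:\<Omega>. P' x ?ei - Q' x ?ej)"
    unfolding set_lebesgue_integral_def
    by (rule Bochner_Integration.integral_cong) (use W in \<open>auto simp: indicator_def\<close>)
  ultimately show "set_integrable lborel \<Omega> (graph_integrand i j f u)"
    and "(LBINT x:\<Omega>. graph_integrand i j f u x) = 0"
    using PQ by simp_all
qed

section \<open>Continuity and support of the test functions and of the tensors of
  \<open>u\<close>\<close>

lemma Cc_on_subset_C0_on: "Cc_on U \<subseteq> C0_on U"
  unfolding C0_on_def by (auto simp: Cc_on_def intro!: bexI[of _ "_ :: 'a \<Rightarrow> 'b"])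

text \<open>The cylinder over \<open>\<Omega> - K\<close> is open, so vanishing passes to the first
  derivatives on all of it, and from there to the second.\<close>

lemma dir_deriv_compact_support:
  fixes f :: "'a::real_normed_vector \<times> 'b::real_normed_vector \<Rightarrow> real"
  assumes "open \<Omega>" "compact K" "\<And>x z. x \<in> \<Omega> - K \<Longrightarrow> f (x, z) = 0" "x \<in> \<Omega> - K"
  shows "dir_deriv e f (x, z) = 0" "dir_deriv e (dir_deriv e' f) (x, z) = 0"
proof -
  have op: "open ((\<Omega> - K) \<times> (UNIV :: 'b set))"
    using assms(1,2) by (intro open_Times open_Diff compact_imp_closed) auto
  have 1: "dir_deriv e f (x, z) = 0" if "x \<in> \<Omega> - K" for x z e
    by (rule dir_deriv_zero[OF op]) (use assms(3) that in auto)
  then show "dir_deriv e f (x, z) = 0"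
    using assms(4) .
  show "dir_deriv e (dir_deriv e' f) (x, z) = 0"
  proof (rule dir_deriv_zero[OF op])
    show "dir_deriv e' f y = 0" if "y \<in> (\<Omega> - K) \<times> UNIV" for y
      using that 1 by (cases y) blast
  qed (use assms(4) in auto)
qed

lemma C2c_on_component:
  fixes \<phi> :: "'a::real_normed_vector \<times> 'b::real_normed_vector \<Rightarrow> real^'m^'n"
  assumes "\<phi> \<in> C2c_on \<Omega>"
  shows "(\<lambda>q. \<phi> q $ i $ j) \<in> C2c_on \<Omega>"
  using assms C2_on_bounded_linear[OF bounded_linear_vec_nth_vec_nth] unfolding C2c_on_def by fastforce

text \<open>Continuity is shown on the open cylinder over \<Omega>, where \<open>C2_on\<close> is
  meaningful; \<Gamma> may have empty interior.\<close>

lemma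
  fixes \<phi> :: "(real^'d::finite) \<times> (real^'s::finite) \<Rightarrow> real^'d^'d"
  assumes \<Omega>: "open \<Omega>" and \<phi>: "\<phi> \<in> C2c_on \<Omega>"
  shows continuous_on_div2_x: "continuous_on (\<Omega> \<times> UNIV) (div2_x \<phi>)"
    and continuous_on_grad_z: "continuous_on (\<Omega> \<times> UNIV) (grad_z \<phi>)"
    and continuous_on_hess_z: "continuous_on (\<Omega> \<times> UNIV) (hess_z \<phi>)"
proof -
  have S: "open (\<Omega> \<times> (UNIV :: (real^'s) set))"
    using \<Omega> by (intro open_Times) auto
  have C2: "C2_on (\<Omega> \<times> UNIV) (\<lambda>q. \<phi> q $ i $ j)" for i j
    using C2c_on_component[OF \<phi>] by (simp add: C2c_on_def)
  show "continuous_on (\<Omega> \<times> UNIV) (div2_x \<phi>)"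
    unfolding div2_x_def[abs_def]
    by (intro continuous_on_sum C2_on_continuous_dir_deriv[OF S C2])
  show "continuous_on (\<Omega> \<times> UNIV) (grad_z \<phi>)"
    unfolding grad_z_def[abs_def]
    by (intro continuous_on_vec_lambda C2_on_continuous_dir_deriv[OF S C2])
  show "continuous_on (\<Omega> \<times> UNIV) (hess_z \<phi>)"
    unfolding hess_z_def[abs_def]
    by (intro continuous_on_vec_lambda C2_on_continuous_dir_deriv[OF S C2])
qed

lemma C2c_on_support:
  fixes \<phi> :: "(real^'d::finite) \<times> (real^'s::finite) \<Rightarrow> real^'d^'d"
  assumes \<Omega>: "open \<Omega>" and \<phi>: "\<phi> \<in> C2c_on \<Omega>"
  obtains K where "compact K" "K \<subseteq> \<Omega>"
    and "\<And>x z. x \<in> \<Omega> - K \<Longrightarrow> div2_x \<phi> (x, z) = 0"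
    and "\<And>x z. x \<in> \<Omega> - K \<Longrightarrow> grad_z \<phi> (x, z) = 0"
    and "\<And>x z. x \<in> \<Omega> - K \<Longrightarrow> hess_z \<phi> (x, z) = 0"
proof -
  obtain K where K: "compact K" "K \<subseteq> \<Omega>" and 0: "\<And>x z. x \<in> \<Omega> - K \<Longrightarrow> \<phi> (x, z) = 0"
    using \<phi> unfolding C2c_on_def by blast
  have D: "dir_deriv e (\<lambda>q. \<phi> q $ i $ j) (x, z) = 0"
    "dir_deriv e (dir_deriv e' (\<lambda>q. \<phi> q $ i $ j)) (x, z) = 0" if "x \<in> \<Omega> - K" for x z i j e e'
    by (rule dir_deriv_compact_support[OF \<Omega> K(1) _ that]; simp add: 0)+
  show thesis
    by (rule that[OF K]) (simp_all add: div2_x_def grad_z_def hess_z_def vec_eq_iff D)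
qed

text \<open>Compactness of \<Gamma> makes \<open>K \<times> \<Gamma>\<close> compact, which turns
  compact support in \<open>x\<close> alone into compact support in
  \<open>\<Omega> \<times> \<Gamma>\<close>.\<close>

lemma continuous_compact_support_in_C0_on:
  fixes f :: "'a::topological_space \<times> 'b::topological_space \<Rightarrow> 'c::real_normed_vector"
  assumes "continuous_on (\<Omega> \<times> UNIV) f" "compact K" "K \<subseteq> \<Omega>" "compact \<Gamma>"
    and "\<And>x z. x \<in> \<Omega> - K \<Longrightarrow> f (x, z) = 0"
  shows "f \<in> C0_on (\<Omega> \<times> \<Gamma>)"
proof -
  have "continuous_on (\<Omega> \<times> \<Gamma>) f"
    using assms(1) by (rule continuous_on_subset) auto
  moreover have "compact (K \<times> \<Gamma>)" "K \<times> \<Gamma> \<subseteq> \<Omega> \<times> \<Gamma>"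
    using assms by (auto intro: compact_Times)
  moreover have "\<forall>p\<in>\<Omega> \<times> \<Gamma> - K \<times> \<Gamma>. f p = 0"
    using assms(5) by auto
  ultimately have "f \<in> Cc_on (\<Omega> \<times> \<Gamma>)"
    unfolding Cc_on_def by blast
  then show ?thesis
    using Cc_on_subset_C0_on by blast
qed

lemma continuous_on_hess:
  assumes \<Omega>: "open \<Omega>" and u: "C2_on \<Omega> u"
  shows "continuous_on \<Omega> (hess u)"
  unfolding hess_def[abs_def]
  by (intro continuous_on_vec_lambda C2_on_continuous_dir_deriv[OF \<Omega>]
      C2_on_bounded_linear[OF bounded_linear_vec_nth u])

lemma continuous_on_grad_tensor_grad:
  assumes \<Omega>: "open \<Omega>" and u: "C2_on \<Omega> u"
  shows "continuous_on \<Omega> (grad_tensor_grad u)"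
  unfolding grad_tensor_grad_def[abs_def]
  by (intro continuous_on_vec_lambda continuous_on_mult C2_on_continuous_dir_deriv[OF \<Omega>]
      C2_on_bounded_linear[OF bounded_linear_vec_nth u])

section \<open>Summation over the indices and conclusion\<close>

lemma sum_graph_integrand:
  "(\<Sum>i\<in>UNIV. \<Sum>j\<in>UNIV. graph_integrand i j (\<lambda>q. \<phi> q $ i $ j) u x) =
     - div2_x \<phi> (x, u x) + grad_z \<phi> (x, u x) \<bullet> hess u x
     + hess_z \<phi> (x, u x) \<bullet> grad_tensor_grad u x"
proof -
  \<comment> \<open>The nested inner product sums in the order \<open>i\<close>, \<open>k\<close>,
    \<open>j\<close>, \<open>l\<close>; exchanging the two middle sums brings \<open>i\<close> and
    \<open>j\<close> to the front.\<close>
  have H: "hess_z \<phi> (x, u x) \<bullet> grad_tensor_grad u x =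
      (\<Sum>i\<in>UNIV. \<Sum>j\<in>UNIV. \<Sum>k\<in>UNIV. \<Sum>l\<in>UNIV. pdz k (pdz l (\<lambda>q. \<phi> q $ i $ j)) (x, u x)
          * (pd i (\<lambda>y. u y $ k) x * pd j (\<lambda>y. u y $ l) x))"
    by (simp add: inner_vec_def hess_z_def grad_tensor_grad_def)
      (intro sum.cong refl sum.swap)
  have G: "grad_z \<phi> (x, u x) \<bullet> hess u x =
      (\<Sum>i\<in>UNIV. \<Sum>j\<in>UNIV. \<Sum>k\<in>UNIV. pdz k (\<lambda>q. \<phi> q $ i $ j) (x, u x)
          * pd i (pd j (\<lambda>y. u y $ k)) x)"
    by (simp add: inner_vec_def grad_z_def hess_def)
  show ?thesis
    unfolding G H
    by (simp add: graph_integrand_def div2_x_def sum.distrib sum_subtractf sum_negf)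
qed

lemma set_integral_sum:
  fixes f :: "'i \<Rightarrow> 'a \<Rightarrow> 'b::{banach, second_countable_topology}"
  assumes "\<And>i. i \<in> I \<Longrightarrow> set_integrable M A (f i)"
  shows "set_integrable M A (\<lambda>x. \<Sum>i\<in>I. f i x)"
    and "(LINT x:A|M. \<Sum>i\<in>I. f i x) = (\<Sum>i\<in>I. LINT x:A|M. f i x)"
  using assms unfolding set_integrable_def set_lebesgue_integral_def scaleR_sum_right
  by (auto intro!: Bochner_Integration.integrable_sum Bochner_Integration.integral_sum)

theorem proposition17:
  fixes \<Omega> :: "(real^'d::finite) set" and \<Gamma> :: "(real^'s::finite) set"
    and u :: "real^'d \<Rightarrow> real^'s"
    and H :: "((real^'d) \<times> (real^'s)) set \<Rightarrow> real^'s^'d^'s^'d"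
    and E :: "((real^'d) \<times> (real^'s)) set \<Rightarrow> real^'s^'d^'d"
    and \<mu> :: "((real^'d) \<times> (real^'s)) set \<Rightarrow> real"
  assumes "open \<Omega>" and "bounded \<Omega>" and "compact \<Gamma>"
    and "C2_on \<Omega> u" and "u ` \<Omega> \<subseteq> \<Gamma>"
    and "finite_radon_measure_on (\<Omega> \<times> \<Gamma>) (\<lambda>A. (H A, E A, \<mu> A))"
    and "\<And>\<phi>. \<phi> \<in> C0_on (\<Omega> \<times> \<Gamma>) \<Longrightarrow>
           pair_integral (\<Omega> \<times> \<Gamma>) \<phi> \<mu> = (LBINT x:\<Omega>. \<phi> (x, u x))"
    and "\<And>\<phi>. \<phi> \<in> C0_on (\<Omega> \<times> \<Gamma>) \<Longrightarrow>
           pair_integral (\<Omega> \<times> \<Gamma>) \<phi> E = (LBINT x:\<Omega>. \<phi> (x, u x) \<bullet> hess u x)"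
    and "\<And>\<phi>. \<phi> \<in> C0_on (\<Omega> \<times> \<Gamma>) \<Longrightarrow>
           pair_integral (\<Omega> \<times> \<Gamma>) \<phi> H = (LBINT x:\<Omega>. \<phi> (x, u x) \<bullet> grad_tensor_grad u x)"
  shows "solves_second_order_continuity_eq \<Omega> \<Gamma> H E \<mu>"
  unfolding solves_second_order_continuity_eq_def
proof
  fix \<phi> :: "(real^'d) \<times> (real^'s) \<Rightarrow> real^'d^'d"
  assume \<phi>: "\<phi> \<in> C2c_on \<Omega>"
  note \<Omega> = \<open>open \<Omega>\<close> and u = \<open>C2_on \<Omega> u\<close>
  obtain K where K: "compact K" "K \<subseteq> \<Omega>"
    and zero: "\<And>x z. x \<in> \<Omega> - K \<Longrightarrow> div2_x \<phi> (x, z) = 0"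
      "\<And>x z. x \<in> \<Omega> - K \<Longrightarrow> grad_z \<phi> (x, z) = 0"
      "\<And>x z. x \<in> \<Omega> - K \<Longrightarrow> hess_z \<phi> (x, z) = 0"
    by (fact C2c_on_support[OF \<Omega> \<phi>])
  note cont = continuous_on_div2_x[OF \<Omega> \<phi>] continuous_on_grad_z[OF \<Omega> \<phi>] continuous_on_hess_z[OF \<Omega> \<phi>]
  \<comment> \<open>The derivatives of \<phi> lie in
    \<open>C0_on (\<Omega> \<times> \<Gamma>)\<close>, so the three representation hypotheses apply
    to them.\<close>
  have eq:
    "pair_integral (\<Omega> \<times> \<Gamma>) (div2_x \<phi>) \<mu> = (LBINT x:\<Omega>. div2_x \<phi> (x, u x))"
    "pair_integral (\<Omega> \<times> \<Gamma>) (grad_z \<phi>) E = (LBINT x:\<Omega>. grad_z \<phi> (x, u x) \<bullet> hess u x)"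
    "pair_integral (\<Omega> \<times> \<Gamma>) (hess_z \<phi>) H = (LBINT x:\<Omega>. hess_z \<phi> (x, u x) \<bullet> grad_tensor_grad u x)"
    using assms(7-9) continuous_compact_support_in_C0_on[OF cont(1) K \<open>compact \<Gamma>\<close> zero(1)]
      continuous_compact_support_in_C0_on[OF cont(2) K \<open>compact \<Gamma>\<close> zero(2)]
      continuous_compact_support_in_C0_on[OF cont(3) K \<open>compact \<Gamma>\<close> zero(3)]
    by blast+
  have "continuous_on \<Omega> u"
    using C2_onE[OF \<Omega> u] by metis
  then have graph: "continuous_on \<Omega> (\<lambda>x. (x, u x))" "(\<lambda>x. (x, u x)) ` \<Omega> \<subseteq> \<Omega> \<times> UNIV"
    by (auto intro!: continuous_on_Pair continuous_on_id)
  \<comment> \<open>The derivatives of \<open>u\<close> are only known to be continuous on \<Omega>;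
    integrability comes from the test factor vanishing off \<open>K\<close>.\<close>
  have int:
    "set_integrable lborel \<Omega> (\<lambda>x. div2_x \<phi> (x, u x))"
    "set_integrable lborel \<Omega> (\<lambda>x. grad_z \<phi> (x, u x) \<bullet> hess u x)"
    "set_integrable lborel \<Omega> (\<lambda>x. hess_z \<phi> (x, u x) \<bullet> grad_tensor_grad u x)"
    by (rule set_integrable_continuous_compact_support[OF _ K],
        intro continuous_on_inner continuous_on_compose2[OF cont(1) graph]
          continuous_on_compose2[OF cont(2) graph] continuous_on_compose2[OF cont(3) graph]
          continuous_on_hess[OF \<Omega> u] continuous_on_grad_tensor_grad[OF \<Omega> u],
        simp add: zero)+
  have "- (LBINT x:\<Omega>. div2_x \<phi> (x, u x)) + (LBINT x:\<Omega>. grad_z \<phi> (x, u x) \<bullet> hess u x)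
      + (LBINT x:\<Omega>. hess_z \<phi> (x, u x) \<bullet> grad_tensor_grad u x)
    = (LBINT x:\<Omega>. (grad_z \<phi> (x, u x) \<bullet> hess u x - div2_x \<phi> (x, u x))
      + hess_z \<phi> (x, u x) \<bullet> grad_tensor_grad u x)"
    using set_integral_add(2)[OF set_integral_diff(1)[OF int(2,1)] int(3)]
      set_integral_diff(2)[OF int(2,1)] by linarith
  also have "\<dots> = (LBINT x:\<Omega>. \<Sum>i\<in>UNIV. \<Sum>j\<in>UNIV. graph_integrand i j (\<lambda>q. \<phi> q $ i $ j) u x)"
    unfolding sum_graph_integrand by (simp add: algebra_simps)
  \<comment> \<open>Sums and integral may be exchanged because each \<open>graph_integrand\<close>
    is integrable on its own.\<close>
  also have "\<dots> = (\<Sum>i\<in>UNIV. \<Sum>j\<in>UNIV. LBINT x:\<Omega>. graph_integrand i j (\<lambda>q. \<phi> q $ i $ j) u x)"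
    using integral_graph_integrand(1)[OF \<Omega> C2c_on_component[OF \<phi>] u]
    by (simp add: set_integral_sum)
  also have "\<dots> = 0"
    by (simp add: integral_graph_integrand(2)[OF \<Omega> C2c_on_component[OF \<phi>] u])
  finally show "- pair_integral (\<Omega> \<times> \<Gamma>) (div2_x \<phi>) \<mu> + pair_integral (\<Omega> \<times> \<Gamma>) (grad_z \<phi>) E
      + pair_integral (\<Omega> \<times> \<Gamma>) (hess_z \<phi>) H = 0"
    unfolding eq .
qed

end
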